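(* For every digraph $\mathcal{G}$, the $1$-path digraph $\mathcal{PG}^{(1)}$ is isomorphic, as a digraph, to the line digraph $\mathcal{L}(\mathcal{G})$ of $\mathcal{G}$.
   Context: A digraph is a pair $\mathcal{G}=(V,E)$ with $V$ a finite set of vertices and $E\subseteq (V\times V)\setminus\{(v,v): v\in V\}$ a set of directed edges (no loops; reciprocal edges allowed). For an edge $e=(v,w)$, the source is $s(e)=v$ and the target is $t(e)=w$. The line digraph $\mathcal{L}(\mathcal{G})$ has as vertices the edges of $\mathcal{G}$, with a directed edge from $e$ to $f$ iff $t(e)=s(f)$. The directed flag complex $\mathrm{dFl}(\mathcal{G})$ has as $k$-simplices the ordered $(k+1)$-cliques of $\mathcal{G}$, i.e. tuples $[v_0,\dots,v_k]$ of vertices with $(v_i,v_j)\in E$ for all $i<j$. The face map $d_j$ deletes the $j$-th entry. For $n\ge 1$, the $n$-path digraph $\mathcal{PG}^{(n)}$ has as vertices the $n$-simplices of $\mathrm{dFl}(\mathcal{G})$, and there is a directed edge $(\sigma,\tau)$ if and only if there are an $(n-1)$-simplex $\alpha$ of $\mathrm{dFl}(\mathcal{G})$ and $i,j\in\{0,\dots,n\}$ with $i<j$ such that $d_i(\sigma)=\alpha=d_j(\tau)$. *)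

theory Defs
  imports "Graph_Theory.Pair_Digraph" "Graph_Theory.Digraph_Isomorphism"
begin

text \<open>
  A digraph (finite vertex set, arcs being ordered pairs of distinct vertices, reciprocal arcs
  allowed) is a model of the locale \<^locale>\<open>pair_digraph\<close>. The source and target of an arc
  are its first and second component.
\<close>

definition line_digraph :: "'v pair_pre_digraph \<Rightarrow> ('v \<times> 'v) pair_pre_digraph" where
  "line_digraph G =
    \<lparr> pverts = parcs G,
      parcs = {(e, f). e \<in> parcs G \<and> f \<in> parcs G \<and> snd e = fst f} \<rparr>"

definition dfl_simplices :: "'v pair_pre_digraph \<Rightarrow> nat \<Rightarrow> 'v list set" where
  "dfl_simplices G k =
    {\<sigma>. length \<sigma> = k + 1 \<and> set \<sigma> \<subseteq> pverts G \<and>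
         (\<forall>i j. i < j \<and> j \<le> k \<longrightarrow> (\<sigma> ! i, \<sigma> ! j) \<in> parcs G)}"

definition face :: "nat \<Rightarrow> 'v list \<Rightarrow> 'v list" where
  "face j \<sigma> = take j \<sigma> @ drop (j + 1) \<sigma>"

text \<open>Only meaningful for \<open>n \<ge> 1\<close>, since \<open>n - 1\<close> is truncated subtraction.\<close>

definition path_digraph :: "nat \<Rightarrow> 'v pair_pre_digraph \<Rightarrow> 'v list pair_pre_digraph" where
  "path_digraph n G =
    \<lparr> pverts = dfl_simplices G n,
      parcs = {(\<sigma>, \<tau>). \<sigma> \<in> dfl_simplices G n \<and> \<tau> \<in> dfl_simplices G n \<and>
        (\<exists>\<alpha> \<in> dfl_simplices G (n - 1). \<exists>i j. i < j \<and> j \<le> n \<and> face i \<sigma> = \<alpha> \<and> \<alpha> = face j \<tau>)} \<rparr>"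

end

theory Submission
  imports Defs
begin

text \<open>A 1-simplex \<open>[u, v]\<close> is just an edge. The only indices i < j in {0, 1} are
  i = 0 and j = 1; \<open>face 0\<close> keeps the target of an edge and \<open>face 1\<close> keeps
  its source. So an arc of the 1-path digraph says that the target of one edge is the source of the
  next, which is adjacency in the line digraph (\<open>parcs_path_digraph_1\<close>). Reading a
  two-entry list as a pair is therefore an isomorphism; as arcs are pairs of vertices, the vertex
  map determines the arc map (\<open>digraph_iso_with_projI\<close>).\<close>

lemma digraph_iso_with_projI:
  fixes G :: "'a pair_pre_digraph" and H :: "'b pair_pre_digraph"
  assumes "pair_wf_digraph G"
    and inj: "inj_on f (pverts G)"
    and verts: "pverts H = f ` pverts G"
    and arcs: "parcs H = map_prod f f ` parcs G"
  shows "digraph_iso (with_proj G) (with_proj H)"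
proof -
  interpret pair_wf_digraph G by fact
  let ?h = "\<lparr>iso_verts = f, iso_arcs = map_prod f f, iso_head = snd, iso_tail = fst\<rparr>"
  \<comment> \<open>Arcs have both ends among the vertices, so injectivity of \<open>f\<close> on
    vertices passes to \<open>map_prod f f\<close> on arcs.\<close>
  have "parcs G \<subseteq> pverts G \<times> pverts G"
    using wellformed' by auto
  then have "inj_on (map_prod f f) (parcs G)"
    using map_prod_inj_on[OF inj inj] inj_on_subset by blast
  then have "digraph_isomorphism ?h"
    using inj wf_digraph_axioms by (simp add: digraph_isomorphism_def)
  moreover have "with_proj H = app_iso ?h (with_proj G)"
    by (simp add: app_iso_def with_proj_def verts arcs)
  ultimately show ?thesis
    unfolding digraph_iso_def by blast
qed

lemma pair_wf_digraph_path_digraph: "pair_wf_digraph (path_digraph n G)"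
  by unfold_locales (auto simp: path_digraph_def)

lemma (in pair_wf_digraph) dfl_simplices_0: "dfl_simplices G 0 = (\<lambda>v. [v]) ` pverts G"
  by (auto simp: dfl_simplices_def length_Suc_conv)

text \<open>The clique condition concerns the index pair (0, 1) alone, and the ends of an arc are
  vertices by well-formedness.\<close>

lemma (in pair_wf_digraph) dfl_simplices_1: "dfl_simplices G 1 = (\<lambda>(u, v). [u, v]) ` parcs G"
proof -
  have less: "i < j \<and> j \<le> 1 \<longleftrightarrow> i = 0 \<and> j = 1" for i j :: nat
    by auto
  show ?thesis
    unfolding dfl_simplices_def less by (auto simp: length_Suc_conv dest: wellformed')
qed

lemma (in pair_wf_digraph) parcs_path_digraph_1:
  "parcs (path_digraph 1 G) =
    {([u, v], [v, w]) | u v w. (u, v) \<in> parcs G \<and> (v, w) \<in> parcs G}"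
proof -
  have ex: "(\<exists>i j. i < j \<and> j \<le> 1 \<and> P i j) \<longleftrightarrow> P 0 1" for P :: "nat \<Rightarrow> nat \<Rightarrow> bool"
  proof
    assume "\<exists>i j. i < j \<and> j \<le> 1 \<and> P i j"
    then obtain i j where ij: "i < j" "j \<le> 1" "P i j" by blast
    then have "i = 0" "j = 1" by auto
    with ij show "P 0 1" by simp
  qed (use zero_less_one in blast)
  have ex': "(\<exists>\<alpha> \<in> dfl_simplices G (1 - 1). \<exists>i j. i < j \<and> j \<le> 1 \<and> face i \<sigma> = \<alpha> \<and> \<alpha> = face j \<tau>)
      \<longleftrightarrow> (\<exists>v \<in> pverts G. face 0 \<sigma> = [v] \<and> face 1 \<tau> = [v])" for \<sigma> \<tau>
    unfolding ex by (auto simp: dfl_simplices_0)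
  \<comment> \<open>The shared face \<open>[v]\<close> is a 0-simplex because \<open>v\<close> is an
    end of an arc.\<close>
  show ?thesis
    unfolding path_digraph_def ex' unfolding dfl_simplices_1
    by (auto simp: face_def dest: wellformed')
qed

theorem proposition3p16:
  fixes G :: "'v pair_pre_digraph"
  assumes "pair_digraph G"
  shows "digraph_iso (with_proj (path_digraph 1 G)) (with_proj (line_digraph G))"
proof -
  interpret pair_digraph G by fact
  \<comment> \<open>On 1-simplices this inverts the map sending \<open>(u, v)\<close> to
    \<open>[u, v]\<close>.\<close>
  let ?f = "\<lambda>\<sigma> :: 'v list. (\<sigma> ! 0, \<sigma> ! 1)"
  have verts: "pverts (path_digraph 1 G) = (\<lambda>(u, v). [u, v]) ` parcs G"
    by (simp add: path_digraph_def dfl_simplices_1[simplified])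
  show ?thesis
  proof (rule digraph_iso_with_projI[where f = ?f])
    show "pair_wf_digraph (path_digraph 1 G)"
      by (rule pair_wf_digraph_path_digraph)
    show "inj_on ?f (pverts (path_digraph 1 G))"
      unfolding verts by (auto intro!: inj_onI)
    show "pverts (line_digraph G) = ?f ` pverts (path_digraph 1 G)"
      unfolding verts by (force simp: line_digraph_def image_image)
    show "parcs (line_digraph G) = map_prod ?f ?f ` parcs (path_digraph 1 G)"
      unfolding parcs_path_digraph_1 by (force simp: line_digraph_def)
  qed
qed

end
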